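(* Let $P,Q$ be proper upward monotone quantifiers on a nonempty set $D$. The following are equivalent. (1) $P\cdot Q=P\boxtimes Q$. (2) Whenever $A\in P$ and $(A_x)_{x\in A}$ is a family with $A_x\in Q$ for every $x\in A$, there is $C\in P$ with $C\subseteq A$ such that $\bigcap_{x\in C}A_x\in Q$.
   Context: A (unary) quantifier on a nonempty set $D$ is a family $Q\subseteq\mathcal P(D)$. It is upward monotone if $A\in Q$ and $A\subseteq B\subseteq D$ imply $B\in Q$; it is proper if $\varnothing\notin Q$ and $D\in Q$. For $R\subseteq D^2$ put $R_x=\{y\in D:(x,y)\in R\}$. The iteration is $P\cdot Q=\{R\subseteq D^2:\{x\in D:R_x\in Q\}\in P\}$. The branching product is $P\boxtimes Q=\{R\subseteq D^2:\exists A\in P\ \exists B\in Q\ (A\times B\subseteq R)\}$. *)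

theory Defs
  imports Main
begin

definition quantifier_on :: "'a set \<Rightarrow> 'a set set \<Rightarrow> bool" where
  "quantifier_on D Q \<longleftrightarrow> Q \<subseteq> Pow D"

definition upward_monotone :: "'a set \<Rightarrow> 'a set set \<Rightarrow> bool" where
  "upward_monotone D Q \<longleftrightarrow> (\<forall>A B. A \<in> Q \<longrightarrow> A \<subseteq> B \<longrightarrow> B \<subseteq> D \<longrightarrow> B \<in> Q)"

definition proper_quantifier :: "'a set \<Rightarrow> 'a set set \<Rightarrow> bool" where
  "proper_quantifier D Q \<longleftrightarrow> {} \<notin> Q \<and> D \<in> Q"

definition rel_section :: "'a set \<Rightarrow> ('a \<times> 'a) set \<Rightarrow> 'a \<Rightarrow> 'a set" where
  "rel_section D R x = {y \<in> D. (x, y) \<in> R}"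

definition iteration :: "'a set \<Rightarrow> 'a set set \<Rightarrow> 'a set set \<Rightarrow> ('a \<times> 'a) set set" where
  "iteration D P Q = {R. R \<subseteq> D \<times> D \<and> {x \<in> D. rel_section D R x \<in> Q} \<in> P}"

definition branching_product :: "'a set \<Rightarrow> 'a set set \<Rightarrow> 'a set set \<Rightarrow> ('a \<times> 'a) set set" where
  "branching_product D P Q = {R. R \<subseteq> D \<times> D \<and> (\<exists>A\<in>P. \<exists>B\<in>Q. A \<times> B \<subseteq> R)}"

end

theory Submission
  imports Defs
begin

text \<open>
  A relation \<open>R\<close> in the iteration yields a set \<open>A \<in> P\<close> together with a family of sets in \<open>Q\<close>
  indexed by \<open>A\<close>, namely its sections; conversely, the disjoint sum of such a family is a relation
  in the iteration (\<open>Sigma_in_iteration\<close>). A rectangle \<open>C \<times> B\<close> lies inside \<open>R\<close> exactly when \<open>B\<close>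
  is contained in every section over \<open>C\<close>. So placing \<open>R\<close> in the branching product amounts to
  finding \<open>C \<in> P\<close> over which the intersection of the sections is still in \<open>Q\<close>, which is the
  condition on families.

  Monotonicity alone gives one inclusion (\<open>branching_product_subset_iteration\<close>), and the other is
  what the condition on families expresses. Properness makes it possible to read a rectangle
  inside the sum of a family as a set of indices: both of its sides are nonempty, so its left side
  consists of indices of the family and the intersection over that side is a subset of \<open>D\<close>.
\<close>

lemma branching_product_subset_iteration:
  assumes "quantifier_on D P" "upward_monotone D P" "upward_monotone D Q"
  shows "branching_product D P Q \<subseteq> iteration D P Q"
proof
  fix R assume "R \<in> branching_product D P Q"
  then obtain A B where R: "R \<subseteq> D \<times> D" and AB: "A \<in> P" "B \<in> Q" "A \<times> B \<subseteq> R"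
    by (auto simp: branching_product_def)
  have "A \<subseteq> {x \<in> D. rel_section D R x \<in> Q}"
  proof
    fix x assume "x \<in> A"
    moreover have "A \<subseteq> D"
      using assms(1) AB(1) by (auto simp: quantifier_on_def)
    moreover have "B \<subseteq> rel_section D R x" "rel_section D R x \<subseteq> D"
      using \<open>x \<in> A\<close> R AB(3) by (auto simp: rel_section_def)
    ultimately show "x \<in> {x \<in> D. rel_section D R x \<in> Q}"
      using assms(3) AB(2) by (auto simp: upward_monotone_def)
  qed
  moreover have "{x \<in> D. rel_section D R x \<in> Q} \<subseteq> D" by blast
  ultimately have "{x \<in> D. rel_section D R x \<in> Q} \<in> P"
    using assms(2) AB(1) unfolding upward_monotone_def by blast
  with R show "R \<in> iteration D P Q"
    by (simp add: iteration_def)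
qed

text \<open>
  Over an index the section of the sum is the corresponding member of the family, and over every
  other point it is empty. As \<open>{} \<notin> Q\<close>, the points whose section lies in \<open>Q\<close> are the indices.
\<close>

lemma Sigma_in_iteration:
  assumes "quantifier_on D P" "quantifier_on D Q" "{} \<notin> Q"
    and "A \<in> P" "\<And>x. x \<in> A \<Longrightarrow> F x \<in> Q"
  shows "Sigma A F \<in> iteration D P Q"
proof -
  have AD: "A \<subseteq> D"
    using assms(1,4) by (auto simp: quantifier_on_def)
  have FD: "F x \<subseteq> D" if "x \<in> A" for x
    using assms(2) assms(5)[OF that] by (auto simp: quantifier_on_def)
  have "rel_section D (Sigma A F) x = (if x \<in> A then F x else {})" for x
    using FD by (auto simp: rel_section_def)
  then have "{x \<in> D. rel_section D (Sigma A F) x \<in> Q} = A"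
    using AD assms(3,5) by auto
  then show ?thesis
    using AD FD assms(4) by (force simp: iteration_def)
qed

theorem proposition2p3:
  fixes D :: "'a set" and P Q :: "'a set set"
  assumes "D \<noteq> {}"
    and "quantifier_on D P" and "quantifier_on D Q"
    and "upward_monotone D P" and "upward_monotone D Q"
    and "proper_quantifier D P" and "proper_quantifier D Q"
  shows "iteration D P Q = branching_product D P Q \<longleftrightarrow>
    (\<forall>A F. A \<in> P \<longrightarrow> (\<forall>x\<in>A. F x \<in> Q) \<longrightarrow>
      (\<exists>C\<in>P. C \<subseteq> A \<and> (\<Inter>x\<in>C. F x) \<in> Q))"
proof (intro iffI allI impI)
  fix A F
  assume eq: "iteration D P Q = branching_product D P Q"
    and A: "A \<in> P" and F: "\<forall>x\<in>A. F x \<in> Q"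
  have "{} \<notin> P" "{} \<notin> Q"
    using assms(6,7) by (auto simp: proper_quantifier_def)
  have "Sigma A F \<in> branching_product D P Q"
    using Sigma_in_iteration[OF assms(2,3) \<open>{} \<notin> Q\<close> A] F eq by blast
  then obtain C B where CB: "C \<in> P" "B \<in> Q" "C \<times> B \<subseteq> Sigma A F"
    by (auto simp: branching_product_def)
  have "C \<noteq> {}" "B \<noteq> {}"
    using CB(1,2) \<open>{} \<notin> P\<close> \<open>{} \<notin> Q\<close> by auto
  then have "C \<subseteq> A"
    using CB(3) by blast
  have "B \<subseteq> (\<Inter>x\<in>C. F x)"
    using CB(3) by blast
  moreover have "(\<Inter>x\<in>C. F x) \<subseteq> D"
    using \<open>C \<noteq> {}\<close> \<open>C \<subseteq> A\<close> F assms(3) by (fastforce simp: quantifier_on_def)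
  ultimately have "(\<Inter>x\<in>C. F x) \<in> Q"
    using assms(5) CB(2) unfolding upward_monotone_def by blast
  with CB(1) \<open>C \<subseteq> A\<close> show "\<exists>C\<in>P. C \<subseteq> A \<and> (\<Inter>x\<in>C. F x) \<in> Q"
    by blast
next
  assume uniform: "\<forall>A F. A \<in> P \<longrightarrow> (\<forall>x\<in>A. F x \<in> Q) \<longrightarrow>
      (\<exists>C\<in>P. C \<subseteq> A \<and> (\<Inter>x\<in>C. F x) \<in> Q)"
  show "iteration D P Q = branching_product D P Q"
  proof
    show "iteration D P Q \<subseteq> branching_product D P Q"
    proof
      fix R assume "R \<in> iteration D P Q"
      then have R: "R \<subseteq> D \<times> D" and "{x \<in> D. rel_section D R x \<in> Q} \<in> P"
        by (auto simp: iteration_def)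
      then obtain C where "C \<in> P" "(\<Inter>x\<in>C. rel_section D R x) \<in> Q"
        using uniform[rule_format, of "{x \<in> D. rel_section D R x \<in> Q}" "rel_section D R"]
        by blast
      moreover have "C \<times> (\<Inter>x\<in>C. rel_section D R x) \<subseteq> R"
        by (auto simp: rel_section_def)
      ultimately show "R \<in> branching_product D P Q"
        using R unfolding branching_product_def by blast
    qed
    show "branching_product D P Q \<subseteq> iteration D P Q"
      using assms(2,4,5) by (rule branching_product_subset_iteration)
  qed
qed

end
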